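(* Let $k$ be a positive integer. An independence system $\mathcal{F}=(S,\mathcal{I})$ is $k$-extendible if and only if all of its contractions $\mathcal{F}/I$, $I\in\mathcal{I}$, are $k$-systems.
   Context: An independence system $(S,\mathcal{I})$ is a finite set $S$ with a nonempty downward-closed family $\mathcal{I}\subseteq2^S$ of independent sets. A basis of $X\subseteq S$ is an inclusion-wise maximal independent subset of $X$. Contraction: for $I\in\mathcal{I}$, $\mathcal{F}/I=(S\setminus I,\mathcal{I}/I)$ with $\mathcal{I}/I=\{X\subseteq S\setminus I: X\cup I\in\mathcal{I}\}$. $k$-extendible: for every $A\subseteq B\in\mathcal{I}$ and $e\in S\setminus B$ with $A\cup\{e\}\in\mathcal{I}$, there is $Z\subseteq B\setminus A$ with $|Z|\le k$ and $(B\cup\{e\})\setminus Z\in\mathcal{I}$. $k$-system: for every $X\subseteq S$ and every two bases $P,Q$ of $X$, $|P|\le k|Q|$. *)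

theory Defs
  imports Main
begin

locale independence_system =
  fixes S :: "'a set" and \<I> :: "'a set set"
  assumes finite_ground: "finite S"
    and indep_subset_ground: "X \<in> \<I> \<Longrightarrow> X \<subseteq> S"
    and indep_nonempty: "\<I> \<noteq> {}"
    and indep_downward: "Y \<in> \<I> \<Longrightarrow> X \<subseteq> Y \<Longrightarrow> X \<in> \<I>"

definition basis_of :: "'a set set \<Rightarrow> 'a set \<Rightarrow> 'a set \<Rightarrow> bool" where
  "basis_of \<I> X P \<longleftrightarrow>
     P \<in> \<I> \<and> P \<subseteq> X \<and> (\<forall>Q. Q \<in> \<I> \<longrightarrow> P \<subseteq> Q \<longrightarrow> Q \<subseteq> X \<longrightarrow> Q = P)"

text \<open>The family of the contraction by \<open>I\<close>; its ground set is \<open>S - I\<close>.\<close>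

definition contract :: "'a set \<Rightarrow> 'a set set \<Rightarrow> 'a set \<Rightarrow> 'a set set" where
  "contract S \<I> I = {X. X \<subseteq> S - I \<and> X \<union> I \<in> \<I>}"

definition k_extendible :: "nat \<Rightarrow> 'a set \<Rightarrow> 'a set set \<Rightarrow> bool" where
  "k_extendible k S \<I> \<longleftrightarrow>
     (\<forall>A B e. A \<subseteq> B \<longrightarrow> B \<in> \<I> \<longrightarrow> e \<in> S - B \<longrightarrow> A \<union> {e} \<in> \<I> \<longrightarrow>
        (\<exists>Z. Z \<subseteq> B - A \<and> card Z \<le> k \<and> (B \<union> {e}) - Z \<in> \<I>))"

definition k_system :: "nat \<Rightarrow> 'a set \<Rightarrow> 'a set set \<Rightarrow> bool" where
  "k_system k S \<I> \<longleftrightarrow>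
     (\<forall>X P Q. X \<subseteq> S \<longrightarrow> basis_of \<I> X P \<longrightarrow> basis_of \<I> X Q \<longrightarrow> card P \<le> k * card Q)"

lemma (in independence_system) independence_system_contract:
  assumes "I \<in> \<I>"
  shows "independence_system (S - I) (contract S \<I> I)"
proof
  show "finite (S - I)" using finite_ground by simp
  show "X \<subseteq> S - I" if "X \<in> contract S \<I> I" for X
    using that by (simp add: contract_def)
  show "contract S \<I> I \<noteq> {}"
    using assms by (auto simp: contract_def intro!: exI[of _ "{}"])
  show "X \<in> contract S \<I> I" if "Y \<in> contract S \<I> I" "X \<subseteq> Y" for X Y
  proof -
    have "Y \<union> I \<in> \<I>" "Y \<subseteq> S - I" using that(1) by (simp_all add: contract_def)
    moreover have "X \<union> I \<subseteq> Y \<union> I" using that(2) by blast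
    ultimately show ?thesis
      using that(2) indep_downward by (auto simp: contract_def)
  qed
qed

end

theory Submission
  imports Defs
begin

text \<open>
  If the system is \<open>k\<close>-extendible and \<open>Q\<close> is a basis of \<open>X\<close>, an independent \<open>P \<subseteq> X\<close> is moved
  towards \<open>Q\<close> by adding the elements of \<open>Q - P\<close> one at a time; each costs at most \<open>k\<close> elements
  of \<open>P - Q\<close>, so \<open>|P - Q| \<le> k |Q - P|\<close>. Conversely, let \<open>Q\<close> be maximal independent with
  \<open>A \<union> {e} \<subseteq> Q \<subseteq> B \<union> {e}\<close>, and put \<open>Z = B - Q\<close>. Unless \<open>B \<union> {e}\<close> is independent, \<open>Z\<close> and \<open>{e}\<close>
  are both bases of \<open>Z \<union> {e}\<close> in the contraction by \<open>B - Z\<close>, whence \<open>|Z| \<le> k\<close>.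
\<close>

text \<open>Adding \<open>I\<close> is an inclusion-preserving bijection from the independent
  subsets of \<open>X\<close> in the contraction to the independent sets between \<open>I\<close>
  and \<open>X \<union> I\<close>, so maximality transfers. Both directions of the theorem use this
  to trade bases of a contraction for bases in the original system.\<close>

lemma basis_of_contract_iff:
  assumes "X \<subseteq> S - I" "I \<subseteq> S" "P \<subseteq> X"
  shows "basis_of (contract S \<I> I) X P \<longleftrightarrow> basis_of \<I> (X \<union> I) (P \<union> I)"
proof
  assume bas: "basis_of (contract S \<I> I) X P"
  show "basis_of \<I> (X \<union> I) (P \<union> I)"
    unfolding basis_of_def
  proof (intro conjI allI impI)
    show "P \<union> I \<in> \<I>" using bas by (simp add: basis_of_def contract_def)
    show "P \<union> I \<subseteq> X \<union> I" using assms by blast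
  next
    fix Q assume Q: "Q \<in> \<I>" "P \<union> I \<subseteq> Q" "Q \<subseteq> X \<union> I"
    have QI: "(Q - I) \<union> I = Q" using Q by blast
    then have "Q - I \<in> contract S \<I> I" using Q assms by (auto simp: contract_def)
    moreover have "P \<subseteq> Q - I" "Q - I \<subseteq> X" using Q assms by blast+
    ultimately have "Q - I = P" using bas by (simp add: basis_of_def)
    then show "Q = P \<union> I" using QI by simp
  qed
next
  assume bas: "basis_of \<I> (X \<union> I) (P \<union> I)"
  show "basis_of (contract S \<I> I) X P"
    unfolding basis_of_def
  proof (intro conjI allI impI)
    show "P \<in> contract S \<I> I" using bas assms by (auto simp: basis_of_def contract_def)
    show "P \<subseteq> X" by fact
  next
    fix Q assume Q: "Q \<in> contract S \<I> I" "P \<subseteq> Q" "Q \<subseteq> X"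
    then have "Q \<union> I \<in> \<I>" "P \<union> I \<subseteq> Q \<union> I" "Q \<union> I \<subseteq> X \<union> I" by (auto simp: contract_def)
    then have "Q \<union> I = P \<union> I" using bas by (simp add: basis_of_def)
    then show "Q = P" using Q assms by blast
  qed
qed

context independence_system
begin

lemma finite_indep: "X \<in> \<I> \<Longrightarrow> finite X"
  using finite_ground finite_subset indep_subset_ground by blast

lemma extend_to_basis:
  assumes "A \<in> \<I>" "A \<subseteq> X" "finite X"
  obtains Q where "basis_of \<I> X Q" "A \<subseteq> Q"
proof -
  let ?F = "{Q \<in> \<I>. Q \<subseteq> X}"
  have "finite ?F" using assms(3) by simp
  moreover have "A \<in> ?F" using assms by simp
  ultimately have "\<exists>Q\<in>?F. A \<subseteq> Q \<and> (\<forall>R\<in>?F. Q \<subseteq> R \<longrightarrow> Q = R)"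
    by (rule finite_has_maximal2)
  then obtain Q where Q: "Q \<in> ?F" "A \<subseteq> Q" and "\<forall>R\<in>?F. Q \<subseteq> R \<longrightarrow> Q = R"
    by (elim bexE conjE)
  then have "basis_of \<I> X Q" by (auto simp: basis_of_def)
  then show ?thesis using Q(2) by (rule that)
qed

text \<open>Induction on \<open>card (Q - P)\<close>. An exchange may destroy maximality of
  \<open>P\<close>, so the claim is made for every independent \<open>P \<subseteq> X\<close>.
  Maximality of \<open>Q\<close> settles the base case: there \<open>Q \<subseteq> P\<close>, hence
  \<open>P = Q\<close>.\<close>

lemma k_extendible_card_Diff_basis_le:
  assumes ext: "k_extendible k S \<I>" and Q: "basis_of \<I> X Q" and "P \<in> \<I>" "P \<subseteq> X"
  shows "card (P - Q) \<le> k * card (Q - P)"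
  using assms(3,4)
proof (induction "card (Q - P)" arbitrary: P)
  case 0
  have Qind: "Q \<in> \<I>" using Q by (simp add: basis_of_def)
  then have "Q \<subseteq> P" using 0 finite_indep by simp
  then have "P = Q" using 0 Q by (simp add: basis_of_def)
  then show ?case by simp
next
  case (Suc n)
  have Qind: "Q \<in> \<I>" "Q \<subseteq> X" using Q by (simp_all add: basis_of_def)
  have "Q - P \<noteq> {}" using Suc.hyps(2) by force
  then obtain e where e: "e \<in> Q" "e \<notin> P" by blast
  \<comment> \<open>Extendibility is applied with \<open>P \<inter> Q\<close> as the smaller set:
    \<open>Z\<close> then avoids \<open>Q\<close>, so no element of \<open>Q\<close> already reached
    is lost and \<open>Q - P\<close> shrinks by exactly \<open>e\<close>.\<close>
  have "P \<inter> Q \<union> {e} \<in> \<I>" using e by (intro indep_downward[OF Qind(1)]) auto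
  moreover have "e \<in> S - P" using Qind e indep_subset_ground by blast
  ultimately have "\<exists>Z. Z \<subseteq> P - P \<inter> Q \<and> card Z \<le> k \<and> (P \<union> {e}) - Z \<in> \<I>"
    by (intro ext[unfolded k_extendible_def, rule_format, OF Int_lower1 \<open>P \<in> \<I>\<close>])
  then obtain Z where Z: "Z \<subseteq> P - P \<inter> Q" "card Z \<le> k" "(P \<union> {e}) - Z \<in> \<I>"
    by blast
  let ?P' = "(P \<union> {e}) - Z"
  have "Q - ?P' = (Q - P) - {e}" using Z e by blast
  then have card': "card (Q - ?P') = n" using Suc.hyps(2) e by simp
  moreover have "?P' \<subseteq> X" using Suc.prems e Qind by blast
  ultimately have IH: "card (?P' - Q) \<le> k * n" using Suc.hyps(1)[of ?P'] Z by simp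
  have "P - Q = (?P' - Q) \<union> Z" using Z e by blast
  then have "card (P - Q) \<le> card (?P' - Q) + card Z" by (simp add: card_Un_le)
  also have "\<dots> \<le> k * Suc n" using IH Z(2) by simp
  finally show ?case using Suc.hyps(2) by simp
qed

lemma k_system_contract_if_k_extendible:
  assumes "k > 0" and ext: "k_extendible k S \<I>" and I: "I \<in> \<I>"
  shows "k_system k (S - I) (contract S \<I> I)"
  unfolding k_system_def
proof (intro allI impI)
  fix X P Q
  assume X: "X \<subseteq> S - I" and P: "basis_of (contract S \<I> I) X P"
    and Q: "basis_of (contract S \<I> I) X Q"
  have sub: "P \<subseteq> X" "Q \<subseteq> X" using P Q by (simp_all add: basis_of_def)
  then have fin: "finite P" "finite Q" using X finite_ground by (meson finite_Diff finite_subset)+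
  note iff = basis_of_contract_iff[OF X indep_subset_ground[OF I]]
  \<comment> \<open>The exchange bound is used in the original system, with \<open>I\<close> added
    to both bases; \<open>I\<close> cancels from the two differences.\<close>
  have "basis_of \<I> (X \<union> I) (P \<union> I)" and bQ: "basis_of \<I> (X \<union> I) (Q \<union> I)"
    using P Q iff sub by auto
  then have "card ((P \<union> I) - (Q \<union> I)) \<le> k * card ((Q \<union> I) - (P \<union> I))"
    by (intro k_extendible_card_Diff_basis_le[OF ext bQ]) (auto simp: basis_of_def)
  moreover have "(P \<union> I) - (Q \<union> I) = P - Q" "(Q \<union> I) - (P \<union> I) = Q - P" using sub X by blast+
  ultimately have "card (P - Q) \<le> k * card (Q - P)" by simp
  \<comment> \<open>The common part counts once in \<open>card P\<close> and \<open>k\<close> times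
    on the right, so \<open>k \<ge> 1\<close> covers it.\<close>
  moreover have "card (P \<inter> Q) \<le> k * card (P \<inter> Q)" using \<open>k > 0\<close> by simp
  moreover have "card P = card (P \<inter> Q) + card (P - Q)" "card Q = card (P \<inter> Q) + card (Q - P)"
    using fin by (metis card_Int_Diff inf_commute)+
  ultimately show "card P \<le> k * card Q"
    by (metis add_mono distrib_left)
qed

lemma k_extendible_if_k_system_contract:
  assumes sys: "\<And>I. I \<in> \<I> \<Longrightarrow> k_system k (S - I) (contract S \<I> I)"
  shows "k_extendible k S \<I>"
  unfolding k_extendible_def
proof (intro allI impI)
  fix A B e
  assume AB: "A \<subseteq> B" and B: "B \<in> \<I>" and e: "e \<in> S - B" and Ae: "A \<union> {e} \<in> \<I>"
  show "\<exists>Z. Z \<subseteq> B - A \<and> card Z \<le> k \<and> (B \<union> {e}) - Z \<in> \<I>"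
  proof (cases "B \<union> {e} \<in> \<I>")
    case True
    then show ?thesis by (intro exI[of _ "{}"]) simp
  next
    case False
    have "A \<union> {e} \<subseteq> B \<union> {e}" "finite (B \<union> {e})" using AB finite_indep[OF B] by auto
    then obtain Q where Q: "basis_of \<I> (B \<union> {e}) Q" "A \<union> {e} \<subseteq> Q"
      by (rule extend_to_basis[OF Ae])
    then have Qsub: "Q \<in> \<I>" "Q \<subseteq> B \<union> {e}" by (simp_all add: basis_of_def)
    define Z where "Z = B - Q"
    \<comment> \<open>Contracting the common part of \<open>B\<close> and \<open>Q\<close> reduces
      \<open>B\<close> to \<open>Z\<close> and \<open>Q\<close> to the single element
      \<open>e\<close>, so the ratio bound becomes \<open>card Z \<le> k * 1\<close>.\<close>
    define I where "I = B \<inter> Q"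
    have I: "I \<in> \<I>" using B indep_downward I_def by blast
    have "Z \<union> {e} \<subseteq> S - I" using indep_subset_ground[OF B] e unfolding Z_def I_def by blast
    note iff = basis_of_contract_iff[OF this indep_subset_ground[OF I], of _ \<I>]
    have un: "Z \<union> {e} \<union> I = B \<union> {e}" "Z \<union> I = B" "{e} \<union> I = Q"
      using Q(2) Qsub e unfolding Z_def I_def by blast+
    \<comment> \<open>The only larger subset of \<open>B \<union> {e}\<close> is the whole set,
      which is dependent in this case.\<close>
    have "basis_of \<I> (B \<union> {e}) B"
      unfolding basis_of_def
    proof (intro conjI allI impI)
      fix R assume R: "R \<in> \<I>" "B \<subseteq> R" "R \<subseteq> B \<union> {e}"
      then have "e \<notin> R" using False by (metis Un_least empty_subsetI insert_subset subset_antisym)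
      then show "R = B" using R by blast
    qed (use B in auto)
    then have "basis_of (contract S \<I> I) (Z \<union> {e}) Z"
      using iff[of Z, unfolded un] by blast
    moreover have "basis_of (contract S \<I> I) (Z \<union> {e}) {e}"
      using iff[of "{e}", unfolded un] Q(1) by blast
    ultimately have "card Z \<le> k * card {e}"
      using sys[OF I] \<open>Z \<union> {e} \<subseteq> S - I\<close> unfolding k_system_def by blast
    moreover have "(B \<union> {e}) - Z = Q" using Q(2) Qsub unfolding Z_def by blast
    moreover have "Z \<subseteq> B - A" using Q(2) unfolding Z_def by blast
    ultimately show ?thesis using Qsub(1) by auto
  qed
qed

end

theorem theorem15:
  fixes k :: nat and S :: "'a set" and \<I> :: "'a set set"
  assumes "k > 0" and "independence_system S \<I>"
  shows "k_extendible k S \<I> \<longleftrightarrow> (\<forall>I\<in>\<I>. k_system k (S - I) (contract S \<I> I))"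
proof -
  interpret independence_system S \<I> by fact
  show ?thesis
    using k_system_contract_if_k_extendible[OF \<open>k > 0\<close>] k_extendible_if_k_system_contract
    by blast
qed

end
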